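(* Let $f:\mathbb{Z}^n\to\mathbb{R}^{p,q}$ be a net in a quadric of $\mathbb{R}^{p,q}$ (with non-vanishing diagonals). Then $f$ is a Moutard net if and only if the edge based net defined by $p^i=f_i-f$ is a parallelogram net in the Clifford algebra $Cl_{p,q}(\mathbb{R})$.
   Context: For maps on $\mathbb{Z}^n$ write $f=f(x)$, $f_i=f(x+e_i)$, $f_{ij}=f(x+e_i+e_j)$ (here $e_i$ are unit vectors of $\mathbb{Z}^n$), and for edge based maps $p^i=p^i(x)$ (value on the edge from $x$ in direction $i$), $p^i_j=p^i(x+e_j)$. $\mathbb{R}^{p,q}$ is $\mathbb{R}^{p+q}$ with the inner product $\langle x,y\rangle=x_1y_1+\dots+x_py_p-x_{p+1}y_{p+1}-\dots-x_{p+q}y_{p+q}$. A net $f$ is in a quadric if $\langle f,f\rangle=\kappa$ for some global constant $\kappa\in\mathbb{R}$. It is a Moutard net if there are real numbers $a_{ij}$ on the faces of $\mathbb{Z}^n$ such that $f_{ij}-f=a_{ij}(f_j-f_i)$ for all $1\leq i<j\leq n$. Only nets are considered for which neither diagonal $f_{ij}-f$, $f_j-f_i$ of any quadrilateral vanishes. $Cl_{p,q}(\mathbb{R})$ is the algebra generated by the standard basis $e_1,\dots,e_{p+q}$ of $\mathbb{R}^{p,q}$ with relations $e_ie_j=-e_je_i$ ($i\neq j$), $e_i^2=-\langle e_i,e_i\rangle$; thus vectors satisfy $ab+ba=-2\langle a,b\rangle$. A parallelogram net in an associative unit algebra is an edge based map such that on every quad $p^i+p^j_i=p^j+p^i_j$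 and $p^j_ip^i=p^i_jp^j$. *)

theory Defs
  imports "Jordan_Normal_Form.Matrix" "HOL-Algebra.QuotRing"
begin

section \<open>Nets in pseudo-Euclidean space\<close>

text \<open>
  The lattice \<open>\<int>\<^sup>n\<close> is \<^term>\<open>carrier_vec n :: int vec set\<close> and the space underlying \<open>\<real>\<^bsup>p,q\<^esup>\<close> is
  \<^term>\<open>carrier_vec (p + q) :: real vec set\<close>. Coordinates and lattice directions are counted
  from 0, and \<open>n\<close>, \<open>p\<close>, \<open>q\<close> are arbitrary (\<open>p = 0\<close> and \<open>q = 0\<close> are allowed).
\<close>

definition pq_inner :: "nat \<Rightarrow> nat \<Rightarrow> real vec \<Rightarrow> real vec \<Rightarrow> real" where
  "pq_inner p q x y = (\<Sum>i = 0..<p. x $ i * y $ i) - (\<Sum>i = p..<p + q. x $ i * y $ i)"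

definition shift :: "nat \<Rightarrow> nat \<Rightarrow> int vec \<Rightarrow> int vec" where
  "shift n i x = x + unit_vec n i"

definition in_quadric :: "nat \<Rightarrow> nat \<Rightarrow> nat \<Rightarrow> (int vec \<Rightarrow> real vec) \<Rightarrow> bool" where
  "in_quadric n p q f \<longleftrightarrow> (\<exists>\<kappa>. \<forall>x \<in> carrier_vec n. pq_inner p q (f x) (f x) = \<kappa>)"

text \<open>
  An elementary quad is given by its base vertex \<open>x\<close> and a pair of directions \<open>i < j\<close>.
\<close>

definition nonvanishing_diagonals :: "nat \<Rightarrow> (int vec \<Rightarrow> real vec) \<Rightarrow> bool" where
  "nonvanishing_diagonals n f \<longleftrightarrow>
     (\<forall>x \<in> carrier_vec n. \<forall>i j. i < j \<and> j < n \<longrightarrow>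
        f (shift n j (shift n i x)) \<noteq> f x \<and> f (shift n j x) \<noteq> f (shift n i x))"

definition moutard_net :: "nat \<Rightarrow> (int vec \<Rightarrow> real vec) \<Rightarrow> bool" where
  "moutard_net n f \<longleftrightarrow>
     (\<exists>a :: nat \<Rightarrow> nat \<Rightarrow> int vec \<Rightarrow> real.
        \<forall>x \<in> carrier_vec n. \<forall>i j. i < j \<and> j < n \<longrightarrow>
          f (shift n j (shift n i x)) - f x = a i j x \<cdot>\<^sub>v (f (shift n j x) - f (shift n i x)))"

text \<open>
  An edge based map is a function \<open>P\<close>, where \<open>P i x\<close> is the value on the edge from \<open>x\<close> in
  direction \<open>i\<close>. Being a parallelogram net involves only addition and multiplication,
  so a ring with unit is enough as the codomain.
\<close>

definition parallelogram_net ::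
    "('a, 'm) ring_scheme \<Rightarrow> nat \<Rightarrow> (nat \<Rightarrow> int vec \<Rightarrow> 'a) \<Rightarrow> bool" where
  "parallelogram_net R n P \<longleftrightarrow>
     (\<forall>x \<in> carrier_vec n. \<forall>i < n. P i x \<in> carrier R) \<and>
     (\<forall>x \<in> carrier_vec n. \<forall>i j. i < j \<and> j < n \<longrightarrow>
        P i x \<oplus>\<^bsub>R\<^esub> P j (shift n i x) = P j x \<oplus>\<^bsub>R\<^esub> P i (shift n j x) \<and>
        P j (shift n i x) \<otimes>\<^bsub>R\<^esub> P i x = P i (shift n j x) \<otimes>\<^bsub>R\<^esub> P j x)"


section \<open>The free algebra\<close>

text \<open>
  The free associative unital \<open>\<real>\<close>-algebra on generators \<open>0, \<dots>, m - 1\<close>: finitely supported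
  real-valued functions on the words over these letters, multiplied by convolution along
  concatenation.
\<close>

definition free_algebra :: "nat \<Rightarrow> (nat list \<Rightarrow> real) ring" where
  "free_algebra m =
     \<lparr> carrier = {a. finite {w. a w \<noteq> 0} \<and> (\<forall>w. a w \<noteq> 0 \<longrightarrow> set w \<subseteq> {..<m})},
       mult = (\<lambda>a b w. \<Sum>(u, v) \<in> {(u, v). u @ v = w}. a u * b v),
       one = (\<lambda>w. if w = [] then 1 else 0),
       zero = (\<lambda>w. 0),
       add = (\<lambda>a b w. a w + b w) \<rparr>"

definition free_scalar :: "real \<Rightarrow> nat list \<Rightarrow> real" where
  "free_scalar r = (\<lambda>w. if w = [] then r else 0)"

definition free_gen :: "nat \<Rightarrow> nat list \<Rightarrow> real" where
  "free_gen i = (\<lambda>w. if w = [i] then 1 else 0)"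

definition free_vector :: "nat \<Rightarrow> real vec \<Rightarrow> nat list \<Rightarrow> real" where
  "free_vector m v = (\<lambda>w. \<Sum>i<m. v $ i * free_gen i w)"

lemma finite_splits: "finite {(u, v). u @ v = w}"
proof (rule finite_subset)
  show "{(u, v). u @ v = w} \<subseteq> (\<lambda>k. (take k w, drop k w)) ` {..length w}"
  proof (rule subsetI, clarify)
    fix u v
    have "(u, v) = (take (length u) (u @ v), drop (length u) (u @ v))" by simp
    then show "(u, v) \<in> (\<lambda>k. (take k (u @ v), drop k (u @ v))) ` {..length (u @ v)}"
      by (rule image_eqI) simp
  qed
qed simp

lemma free_mult_closed:
  assumes a: "a \<in> carrier (free_algebra m)" and b: "b \<in> carrier (free_algebra m)"
  shows "a \<otimes>\<^bsub>free_algebra m\<^esub> b \<in> carrier (free_algebra m)"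
proof -
  let ?c = "a \<otimes>\<^bsub>free_algebra m\<^esub> b"
  let ?S = "{u. a u \<noteq> 0} \<times> {v. b v \<noteq> 0}"
  have supp: "\<exists>u v. w = u @ v \<and> a u \<noteq> 0 \<and> b v \<noteq> 0" if "?c w \<noteq> 0" for w
  proof -
    from that have "(\<Sum>(u, v) \<in> {(u, v). u @ v = w}. a u * b v) \<noteq> 0"
      by (simp add: free_algebra_def)
    then have "\<not> (\<forall>z \<in> {(u, v). u @ v = w}. (case z of (u, v) \<Rightarrow> a u * b v) = 0)"
      by (metis (no_types, lifting) sum.neutral)
    then show ?thesis by auto
  qed
  have "finite ((\<lambda>(u, v). u @ v) ` ?S)"
    using a b by (auto simp: free_algebra_def)
  moreover have "{w. ?c w \<noteq> 0} \<subseteq> (\<lambda>(u, v). u @ v) ` ?S"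
    using supp by fastforce
  ultimately have "finite {w. ?c w \<noteq> 0}"
    by (rule rev_finite_subset)
  moreover have "set w \<subseteq> {..<m}" if w: "?c w \<noteq> 0" for w
  proof -
    obtain u v where uv: "w = u @ v" "a u \<noteq> 0" "b v \<noteq> 0" using supp[OF w] by blast
    have "set u \<subseteq> {..<m}" "set v \<subseteq> {..<m}"
      using a b uv by (auto simp: free_algebra_def)
    then show ?thesis using uv by simp
  qed
  ultimately show ?thesis by (simp add: free_algebra_def)
qed

lemma free_mult_assoc:
  "(a \<otimes>\<^bsub>free_algebra m\<^esub> b) \<otimes>\<^bsub>free_algebra m\<^esub> c =
   a \<otimes>\<^bsub>free_algebra m\<^esub> (b \<otimes>\<^bsub>free_algebra m\<^esub> c)"
proof
  fix w
  let ?S = "\<lambda>w :: nat list. {(u, v). u @ v = w}"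
  have "((a \<otimes>\<^bsub>free_algebra m\<^esub> b) \<otimes>\<^bsub>free_algebra m\<^esub> c) w =
        (\<Sum>z \<in> ?S w. \<Sum>y \<in> ?S (fst z). a (fst y) * b (snd y) * c (snd z))"
    by (simp add: free_algebra_def case_prod_unfold sum_distrib_right)
  also have "\<dots> = (\<Sum>(z, y) \<in> Sigma (?S w) (\<lambda>z. ?S (fst z)). a (fst y) * b (snd y) * c (snd z))"
    by (rule sum.Sigma) (auto simp: finite_splits)
  also have "\<dots> = (\<Sum>(z, y) \<in> Sigma (?S w) (\<lambda>z. ?S (snd z)). a (fst z) * (b (fst y) * c (snd y)))"
    by (rule sum.reindex_bij_witness[of _
          "\<lambda>(z, y). ((fst z @ fst y, snd y), (fst z, fst y))"
          "\<lambda>(z, y). ((fst y, snd y @ snd z), (snd y, snd z))"]) auto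
  also have "\<dots> = (\<Sum>z \<in> ?S w. \<Sum>y \<in> ?S (snd z). a (fst z) * (b (fst y) * c (snd y)))"
    by (rule sum.Sigma[symmetric]) (auto simp: finite_splits)
  also have "\<dots> = (a \<otimes>\<^bsub>free_algebra m\<^esub> (b \<otimes>\<^bsub>free_algebra m\<^esub> c)) w"
    by (simp add: free_algebra_def case_prod_unfold sum_distrib_left)
  finally show "((a \<otimes>\<^bsub>free_algebra m\<^esub> b) \<otimes>\<^bsub>free_algebra m\<^esub> c) w =
    (a \<otimes>\<^bsub>free_algebra m\<^esub> (b \<otimes>\<^bsub>free_algebra m\<^esub> c)) w" .
qed

lemma free_scalar_mult: "free_scalar r \<otimes>\<^bsub>free_algebra m\<^esub> a = (\<lambda>w. r * a w)"
proof
  fix w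
  have "(free_scalar r \<otimes>\<^bsub>free_algebra m\<^esub> a) w =
      (\<Sum>z \<in> {(u, v). u @ v = w}. if z = ([], w) then r * a w else 0)"
    unfolding free_algebra_def free_scalar_def by (auto intro!: sum.cong)
  also have "\<dots> = r * a w"
    by (simp add: finite_splits)
  finally show "(free_scalar r \<otimes>\<^bsub>free_algebra m\<^esub> a) w = r * a w" .
qed

lemma free_mult_scalar: "a \<otimes>\<^bsub>free_algebra m\<^esub> free_scalar r = (\<lambda>w. r * a w)"
proof
  fix w
  have "(a \<otimes>\<^bsub>free_algebra m\<^esub> free_scalar r) w =
      (\<Sum>z \<in> {(u, v). u @ v = w}. if z = (w, []) then r * a w else 0)"
    unfolding free_algebra_def free_scalar_def by (auto intro!: sum.cong)
  also have "\<dots> = r * a w"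
    by (simp add: finite_splits)
  finally show "(a \<otimes>\<^bsub>free_algebra m\<^esub> free_scalar r) w = r * a w" .
qed

lemma free_one: "\<one>\<^bsub>free_algebra m\<^esub> = free_scalar 1"
  by (simp add: free_algebra_def free_scalar_def)

lemma free_add_closed:
  assumes "a \<in> carrier (free_algebra m)" "b \<in> carrier (free_algebra m)"
  shows "a \<oplus>\<^bsub>free_algebra m\<^esub> b \<in> carrier (free_algebra m)"
proof -
  have "finite ({w. a w \<noteq> 0} \<union> {w. b w \<noteq> 0})"
    using assms by (simp add: free_algebra_def)
  then have "finite {w. a w + b w \<noteq> 0}"
    by (rule rev_finite_subset) auto
  moreover have "set w \<subseteq> {..<m}" if "a w + b w \<noteq> 0" for w
  proof -
    from that have "a w \<noteq> 0 \<or> b w \<noteq> 0" by auto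
    then show ?thesis using assms by (auto simp: free_algebra_def)
  qed
  ultimately show ?thesis by (simp add: free_algebra_def)
qed

lemma free_distrib_right:
  "(a \<oplus>\<^bsub>free_algebra m\<^esub> b) \<otimes>\<^bsub>free_algebra m\<^esub> c =
   a \<otimes>\<^bsub>free_algebra m\<^esub> c \<oplus>\<^bsub>free_algebra m\<^esub> b \<otimes>\<^bsub>free_algebra m\<^esub> c"
  by (simp add: free_algebra_def case_prod_unfold distrib_right sum.distrib)

lemma free_distrib_left:
  "c \<otimes>\<^bsub>free_algebra m\<^esub> (a \<oplus>\<^bsub>free_algebra m\<^esub> b) =
   c \<otimes>\<^bsub>free_algebra m\<^esub> a \<oplus>\<^bsub>free_algebra m\<^esub> c \<otimes>\<^bsub>free_algebra m\<^esub> b"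
  by (simp add: free_algebra_def case_prod_unfold distrib_left sum.distrib)

lemma ring_free_algebra: "ring (free_algebra m)"
proof (rule ringI)
  show "abelian_group (free_algebra m)"
  proof (rule abelian_groupI)
    fix a assume "a \<in> carrier (free_algebra m)"
    then have "(\<lambda>w. - a w) \<in> carrier (free_algebra m)"
      by (simp add: free_algebra_def)
    moreover have "(\<lambda>w. - a w) \<oplus>\<^bsub>free_algebra m\<^esub> a = \<zero>\<^bsub>free_algebra m\<^esub>"
      by (simp add: free_algebra_def)
    ultimately show
      "\<exists>b \<in> carrier (free_algebra m). b \<oplus>\<^bsub>free_algebra m\<^esub> a = \<zero>\<^bsub>free_algebra m\<^esub>"
      by blast
  next
    show "\<zero>\<^bsub>free_algebra m\<^esub> \<in> carrier (free_algebra m)"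
      by (simp add: free_algebra_def)
  next
    fix a b c
    show "a \<oplus>\<^bsub>free_algebra m\<^esub> b \<oplus>\<^bsub>free_algebra m\<^esub> c =
        a \<oplus>\<^bsub>free_algebra m\<^esub> (b \<oplus>\<^bsub>free_algebra m\<^esub> c)"
      by (simp add: free_algebra_def add.assoc)
    show "a \<oplus>\<^bsub>free_algebra m\<^esub> b = b \<oplus>\<^bsub>free_algebra m\<^esub> a"
      by (simp add: free_algebra_def add.commute)
    show "\<zero>\<^bsub>free_algebra m\<^esub> \<oplus>\<^bsub>free_algebra m\<^esub> a = a"
      by (simp add: free_algebra_def)
  qed (rule free_add_closed)
  show "monoid (free_algebra m)"
  proof (rule monoidI)
    show "\<one>\<^bsub>free_algebra m\<^esub> \<in> carrier (free_algebra m)"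
      by (simp add: free_algebra_def)
  qed (simp_all only: free_mult_closed free_mult_assoc free_one free_scalar_mult free_mult_scalar mult_1)
qed (rule free_distrib_right free_distrib_left)+

lemma free_scalar_closed: "free_scalar r \<in> carrier (free_algebra m)"
  by (simp add: free_algebra_def free_scalar_def)

lemma free_gen_closed: "i < m \<Longrightarrow> free_gen i \<in> carrier (free_algebra m)"
  by (simp add: free_algebra_def free_gen_def)

lemma free_vector_closed: "free_vector m v \<in> carrier (free_algebra m)"
proof -
  have supp: "\<exists>i < m. w = [i]" if "free_vector m v w \<noteq> 0" for w
  proof (rule ccontr)
    assume "\<not> (\<exists>i < m. w = [i])"
    then have "free_vector m v w = 0"
      unfolding free_vector_def free_gen_def by (intro sum.neutral) auto
    with that show False by simp
  qed
  have "finite ((\<lambda>i. [i]) ` {..<m})" by simp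
  then have "finite {w. free_vector m v w \<noteq> 0}"
    by (rule rev_finite_subset) (use supp in blast)
  moreover have "set w \<subseteq> {..<m}" if "free_vector m v w \<noteq> 0" for w
    using supp[OF that] by auto
  ultimately show ?thesis by (simp add: free_algebra_def)
qed


section \<open>The Clifford algebra\<close>

text \<open>
  \<open>Cl\<^bsub>p,q\<^esub>(\<real>)\<close> is presented by the generators \<open>e\<^sub>i\<close> and the relations \<open>e\<^sub>i e\<^sub>j = - e\<^sub>j e\<^sub>i\<close> for
  \<open>i \<noteq> j\<close> and \<open>e\<^sub>i\<^sup>2 = - \<langle>e\<^sub>i, e\<^sub>i\<rangle>\<close>: it is the quotient of the free algebra by the two-sided ideal
  generated by the relators. A ring ideal of a unital algebra is automatically closed under
  scalars, the scalar \<open>r\<close> being the element \<^term>\<open>free_scalar r\<close>.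
\<close>

definition clifford_relators :: "nat \<Rightarrow> nat \<Rightarrow> (nat list \<Rightarrow> real) set" where
  "clifford_relators p q =
     {free_gen i \<otimes>\<^bsub>free_algebra (p + q)\<^esub> free_gen j \<oplus>\<^bsub>free_algebra (p + q)\<^esub>
        free_gen j \<otimes>\<^bsub>free_algebra (p + q)\<^esub> free_gen i | i j. i < p + q \<and> j < p + q \<and> i \<noteq> j} \<union>
     {free_gen i \<otimes>\<^bsub>free_algebra (p + q)\<^esub> free_gen i \<oplus>\<^bsub>free_algebra (p + q)\<^esub>
        free_scalar (pq_inner p q (unit_vec (p + q) i) (unit_vec (p + q) i)) | i. i < p + q}"

definition clifford_ideal :: "nat \<Rightarrow> nat \<Rightarrow> (nat list \<Rightarrow> real) set" where
  "clifford_ideal p q = Idl\<^bsub>free_algebra (p + q)\<^esub> (clifford_relators p q)"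

definition clifford :: "nat \<Rightarrow> nat \<Rightarrow> (nat list \<Rightarrow> real) set ring" where
  "clifford p q = free_algebra (p + q) Quot clifford_ideal p q"

text \<open>
  The canonical map \<open>\<real>\<^bsup>p,q\<^esup> \<rightarrow> Cl\<^bsub>p,q\<^esub>(\<real>)\<close>, through which vectors are regarded as
  elements of the Clifford algebra.
\<close>

definition clifford_vec :: "nat \<Rightarrow> nat \<Rightarrow> real vec \<Rightarrow> (nat list \<Rightarrow> real) set" where
  "clifford_vec p q v = clifford_ideal p q +>\<^bsub>free_algebra (p + q)\<^esub> free_vector (p + q) v"

lemma clifford_relators_closed: "clifford_relators p q \<subseteq> carrier (free_algebra (p + q))"
  unfolding clifford_relators_def
  by (auto intro!: free_add_closed free_mult_closed free_gen_closed free_scalar_closed)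

lemma ideal_clifford_ideal: "ideal (clifford_ideal p q) (free_algebra (p + q))"
  unfolding clifford_ideal_def
  by (intro ring.genideal_ideal ring_free_algebra clifford_relators_closed)

lemma ring_clifford: "ring (clifford p q)"
  unfolding clifford_def by (rule ideal.quotient_is_ring[OF ideal_clifford_ideal])

lemma clifford_vec_closed: "clifford_vec p q v \<in> carrier (clifford p q)"
proof -
  have "carrier (clifford p q) = a_rcosets\<^bsub>free_algebra (p + q)\<^esub> (clifford_ideal p q)"
    by (simp add: clifford_def FactRing_def)
  then show ?thesis
    using free_vector_closed by (simp only: clifford_vec_def A_RCOSETS_def') blast
qed

end

theory Submission
  imports Defs
begin

text \<open>
  On a quad with vertices \<open>A = f\<close>, \<open>B = f\<^sub>i\<close>, \<open>C = f\<^sub>j\<close>, \<open>E = f\<^sub>i\<^sub>j\<close> the additive condition is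
  automatic, and with \<open>P = B - A\<close>, \<open>D = C - B\<close> the multiplicative one reads
  \<open>(E - A) D = P D + D P + D\<^sup>2\<close>, whose right-hand side is a scalar. A product of two vectors is a
  scalar only if the vectors are parallel, which gives the Moutard equation; conversely, if the
  diagonals are parallel both sides are scalars, and the quadric condition makes them agree.
\<close>

section \<open>Parity of inversions and the sign of a word\<close>

fun inversions :: "nat list \<Rightarrow> nat" where
  "inversions [] = 0"
| "inversions (x # xs) = length (filter (\<lambda>y. y < x) xs) + inversions xs"

text \<open>Letters of \<open>u\<close> see the same letters behind them in either order, and so
  does \<open>v\<close>; only the pair itself gains or loses one inversion.\<close>

lemma inversions_swap:
  "i \<noteq> j \<Longrightarrow> even (inversions (u @ i # j # v)) \<longleftrightarrow> odd (inversions (u @ j # i # v))"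
  by (induction u) auto

text \<open>Each letter of \<open>u\<close> is inverted with both copies of \<open>i\<close> or with
  neither, and both copies have equally many inversions with \<open>v\<close>, so every change is
  even.\<close>

lemma inversions_square: "even (inversions (u @ i # i # v)) \<longleftrightarrow> even (inversions (u @ v))"
  by (induction u) auto

text \<open>
  In the Clifford algebra a word \<open>w\<close> is, up to sign, the product of the \<open>e\<^sub>i\<close> over the set of letters
  \<open>i\<close> of odd multiplicity in \<open>w\<close>, in increasing order. The function below is that sign if this set
  is \<open>K\<close>: sorting contributes the inversions, and each cancelled pair \<open>e\<^sub>i\<^sup>2\<close> with \<open>i < p\<close> a
  factor \<open>- 1\<close>.
\<close>

definition basis_coeff :: "nat \<Rightarrow> nat set \<Rightarrow> nat list \<Rightarrow> real" where
  "basis_coeff p K w =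
     (if \<forall>i. odd (count_list w i) \<longleftrightarrow> i \<in> K
      then (- 1) ^ (inversions w + (\<Sum>i<p. count_list w i div 2)) else 0)"

lemma basis_coeff_swap:
  assumes "i \<noteq> j"
  shows "basis_coeff p K (u @ [i, j] @ v) = - basis_coeff p K (u @ [j, i] @ v)"
proof -
  have "count_list (u @ [i, j] @ v) = count_list (u @ [j, i] @ v)"
    by (auto simp: fun_eq_iff)
  then show ?thesis
    using inversions_swap[OF assms, of u v]
    by (auto simp: basis_coeff_def power_add minus_one_power_iff)
qed

text \<open>The set of letters of odd multiplicity stays the same and one more pair is cancelled.
  The factor is the value of \<open>e\<^sub>i\<^sup>2\<close>.\<close>

lemma basis_coeff_square:
  "basis_coeff p K (u @ [i, i] @ v) = (if i < p then - 1 else 1) * basis_coeff p K (u @ v)"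
proof -
  have c: "count_list (u @ [i, i] @ v) k = count_list (u @ v) k + (if k = i then 2 else 0)" for k
    by auto
  have "(\<Sum>k<p. count_list (u @ [i, i] @ v) k div 2)
      = (\<Sum>k<p. count_list (u @ v) k div 2 + (if k = i then 1 else 0))"
    by (intro sum.cong refl) (simp add: c)
  also have "\<dots> = (\<Sum>k<p. count_list (u @ v) k div 2) + (if i < p then 1 else 0)"
    by (simp add: sum.distrib)
  finally have s: "(\<Sum>k<p. count_list (u @ [i, i] @ v) k div 2)
      = (\<Sum>k<p. count_list (u @ v) k div 2) + (if i < p then 1 else 0)" .
  have o: "odd (count_list (u @ [i, i] @ v) k) \<longleftrightarrow> odd (count_list (u @ v) k)" for k
    by (simp only: c) simp
  show ?thesis
    unfolding basis_coeff_def o s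
    using inversions_square[of u i v]
    by (auto simp: power_add minus_one_power_iff)
qed

lemma basis_coeff_pair:
  assumes "k < l"
  shows "basis_coeff p {k, l} [i, j] =
    (if i = k \<and> j = l then 1 else if i = l \<and> j = k then - 1 else 0)"
proof -
  have odd: "odd (count_list [i, j] h) \<longleftrightarrow> (i = h) \<noteq> (j = h)" for h
    by simp
  have "(\<forall>h. odd (count_list [i, j] h) \<longleftrightarrow> h \<in> {k, l}) \<longleftrightarrow> i = k \<and> j = l \<or> i = l \<and> j = k"
  proof
    assume "\<forall>h. odd (count_list [i, j] h) \<longleftrightarrow> h \<in> {k, l}"
    from spec[OF this, of k] spec[OF this, of l] show "i = k \<and> j = l \<or> i = l \<and> j = k"
      unfolding odd using assms by auto
  next
    assume "i = k \<and> j = l \<or> i = l \<and> j = k"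
    then show "\<forall>h. odd (count_list [i, j] h) \<longleftrightarrow> h \<in> {k, l}"
      unfolding odd using assms by auto
  qed
  moreover have "(\<Sum>h<p. count_list [i, j] h div 2) = 0" if "i \<noteq> j"
    using that by (intro sum.neutral) auto
  ultimately show ?thesis
    using assms by (auto simp: basis_coeff_def)
qed

section \<open>Linear functionals on the free algebra\<close>

definition lin_ext :: "(nat list \<Rightarrow> real) \<Rightarrow> (nat list \<Rightarrow> real) \<Rightarrow> real" where
  "lin_ext \<phi> a = (\<Sum>w | a w \<noteq> 0. a w * \<phi> w)"

lemma lin_ext_superset:
  assumes "finite A" "{w. a w \<noteq> 0} \<subseteq> A"
  shows "lin_ext \<phi> a = (\<Sum>w\<in>A. a w * \<phi> w)"
  unfolding lin_ext_def by (rule sum.mono_neutral_left) (use assms in auto)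

lemma free_finite: "a \<in> carrier (free_algebra m) \<Longrightarrow> finite {w. a w \<noteq> 0}"
  by (simp add: free_algebra_def)

lemma free_add_apply: "(a \<oplus>\<^bsub>free_algebra m\<^esub> b) w = a w + b w"
  by (simp add: free_algebra_def)

lemma lin_ext_add:
  assumes "a \<in> carrier (free_algebra m)" "b \<in> carrier (free_algebra m)"
  shows "lin_ext \<phi> (a \<oplus>\<^bsub>free_algebra m\<^esub> b) = lin_ext \<phi> a + lin_ext \<phi> b"
proof -
  let ?A = "{w. a w \<noteq> 0} \<union> {w. b w \<noteq> 0}"
  have A: "finite ?A" using assms by (simp add: free_finite)
  have "lin_ext \<phi> (a \<oplus>\<^bsub>free_algebra m\<^esub> b) = (\<Sum>w\<in>?A. (a w + b w) * \<phi> w)"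
    by (subst lin_ext_superset[OF A]) (auto simp: free_add_apply)
  then show ?thesis
    by (simp add: lin_ext_superset[OF A] distrib_right sum.distrib)
qed

text \<open>Convolution groups the pairs of words by their concatenation; undoing the grouping
  leaves a sum over the product of the two supports.\<close>

lemma lin_ext_mult:
  assumes a: "a \<in> carrier (free_algebra m)" and b: "b \<in> carrier (free_algebra m)"
  shows "lin_ext \<phi> (a \<otimes>\<^bsub>free_algebra m\<^esub> b)
    = (\<Sum>u | a u \<noteq> 0. \<Sum>v | b v \<noteq> 0. a u * b v * \<phi> (u @ v))"
proof -
  let ?c = "a \<otimes>\<^bsub>free_algebra m\<^esub> b"
  let ?S = "\<lambda>w :: nat list. {(u, v). u @ v = w}"
  let ?P = "{u. a u \<noteq> 0} \<times> {v. b v \<noteq> 0}"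
  let ?W = "(\<lambda>(u, v). u @ v) ` ?P"
  have P: "finite ?P" using a b by (simp add: free_finite)
  have c: "?c w = (\<Sum>z\<in>?S w \<inter> ?P. a (fst z) * b (snd z))" for w
    unfolding free_algebra_def
    by (auto simp: case_prod_unfold finite_splits[unfolded case_prod_unfold] intro!: sum.mono_neutral_right)
  have supp: "{w. ?c w \<noteq> 0} \<subseteq> ?W"
  proof
    fix w assume "w \<in> {w. ?c w \<noteq> 0}"
    then have "?S w \<inter> ?P \<noteq> {}" unfolding c by (metis (mono_tags, lifting) mem_Collect_eq sum.empty)
    then show "w \<in> ?W" by force
  qed
  \<comment> \<open>Terms from different splittings of a word may cancel, so \<open>?W\<close> can
    be strictly larger than the support of \<open>?c\<close>.\<close>
  have "lin_ext \<phi> ?c = (\<Sum>w\<in>?W. ?c w * \<phi> w)"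
    by (rule lin_ext_superset) (use P supp in auto)
  also have "\<dots> = (\<Sum>w\<in>?W. \<Sum>z | z \<in> ?P \<and> (\<lambda>(u, v). u @ v) z = w. a (fst z) * b (snd z) * \<phi> (fst z @ snd z))"
    unfolding c sum_distrib_right by (intro sum.cong refl) auto
  also have "\<dots> = (\<Sum>z\<in>?P. a (fst z) * b (snd z) * \<phi> (fst z @ snd z))"
    by (rule sum.group) (use P in auto)
  finally show ?thesis
    by (simp add: sum.cartesian_product case_prod_unfold)
qed

lemma free_a_inv:
  assumes "a \<in> carrier (free_algebra m)"
  shows "\<ominus>\<^bsub>free_algebra m\<^esub> a = (\<lambda>w. - a w)"
proof -
  interpret ring "free_algebra m" by (rule ring_free_algebra)
  show ?thesis
    by (rule minus_equality) (use assms in \<open>simp_all add: free_algebra_def\<close>)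
qed

lemma clifford_relators_cases:
  assumes "a \<in> clifford_relators p q"
  obtains i j where "i \<noteq> j" "i < p + q" "j < p + q"
      "a = free_gen i \<otimes>\<^bsub>free_algebra (p + q)\<^esub> free_gen j \<oplus>\<^bsub>free_algebra (p + q)\<^esub>
        free_gen j \<otimes>\<^bsub>free_algebra (p + q)\<^esub> free_gen i"
  | i where "i < p + q" "a = free_gen i \<otimes>\<^bsub>free_algebra (p + q)\<^esub> free_gen i
      \<oplus>\<^bsub>free_algebra (p + q)\<^esub>
        free_scalar (pq_inner p q (unit_vec (p + q) i) (unit_vec (p + q) i))"
  using assms unfolding clifford_relators_def by blast

text \<open>
  The annihilator of all two-sided translates of \<open>\<phi>\<close> is an ideal, so on the ideal generated by
  \<open>S\<close> it suffices to test the translates on \<open>S\<close>.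
\<close>

lemma lin_ext_genideal:
  assumes S: "S \<subseteq> carrier (free_algebra m)"
    and \<phi>: "\<And>a u v. a \<in> S \<Longrightarrow> lin_ext (\<lambda>w. \<phi> (u @ w @ v)) a = 0"
    and a: "a \<in> Idl\<^bsub>free_algebra m\<^esub> S"
  shows "lin_ext \<phi> a = 0"
proof -
  let ?F = "free_algebra m"
  interpret F: ring ?F by (rule ring_free_algebra)
  define J where "J = {a \<in> carrier ?F. \<forall>u v. lin_ext (\<lambda>w. \<phi> (u @ w @ v)) a = 0}"
  have "ideal J ?F"
  proof (rule idealI)
    show "subgroup J (add_monoid ?F)"
    proof (rule subgroup.intro)
      show "\<one>\<^bsub>add_monoid ?F\<^esub> \<in> J"
        using F.zero_closed by (simp add: J_def) (simp add: free_algebra_def lin_ext_def)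
    next
      fix a assume "a \<in> J"
      then have "(\<lambda>w. - a w) \<in> J"
        using F.a_inv_closed[of a] by (auto simp: J_def free_a_inv lin_ext_def sum_negf)
      then show "inv\<^bsub>add_monoid ?F\<^esub> a \<in> J"
        using free_a_inv[of a m] \<open>a \<in> J\<close> unfolding a_inv_def by (simp add: J_def)
    qed (auto simp: J_def lin_ext_add)
  next
    fix a x assume J: "a \<in> J" and x: "x \<in> carrier ?F"
    then have a: "a \<in> carrier ?F" and 0: "(\<Sum>w | a w \<noteq> 0. a w * \<phi> (u @ w @ v)) = 0" for u v
      by (auto simp: J_def lin_ext_def)
    \<comment> \<open>Left multiplication by a word \<open>y\<close> turns the context
      \<open>u\<close> into \<open>u @ y\<close>, in which \<open>a\<close> is annihilated as
      well.\<close>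
    have "(\<Sum>y | x y \<noteq> 0. \<Sum>w | a w \<noteq> 0. x y * a w * \<phi> (u @ (y @ w) @ v)) = 0" for u v
      using 0[of "u @ _" v] by (simp add: mult.assoc flip: sum_distrib_left)
    then show "x \<otimes>\<^bsub>?F\<^esub> a \<in> J"
      using a x by (simp add: J_def lin_ext_mult)
    \<comment> \<open>Right multiplication likewise turns \<open>v\<close> into
      \<open>y @ v\<close>; the sum over \<open>w\<close> is kept inside here and the order is
      exchanged afterwards.\<close>
    have "(\<Sum>y | x y \<noteq> 0. \<Sum>w | a w \<noteq> 0. x y * (a w * \<phi> (u @ (w @ y) @ v))) = 0" for u v
      using 0[of u "_ @ v"] by (simp flip: sum_distrib_left)
    then have "(\<Sum>w | a w \<noteq> 0. \<Sum>y | x y \<noteq> 0. a w * x y * \<phi> (u @ (w @ y) @ v)) = 0" for u v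
      by (subst sum.swap) (simp add: ac_simps)
    then show "a \<otimes>\<^bsub>?F\<^esub> x \<in> J"
      using a x by (simp add: J_def lin_ext_mult)
  qed (rule ring_free_algebra)
  moreover have "S \<subseteq> J"
    using S \<phi> by (auto simp: J_def)
  ultimately have "a \<in> J"
    using F.genideal_minimal a by blast
  then have "lin_ext (\<lambda>w. \<phi> ([] @ w @ [])) a = 0"
    unfolding J_def by blast
  then show ?thesis by simp
qed

section \<open>Functionals that descend to the Clifford algebra\<close>

lemma lin_ext_gen_mult:
  assumes "i < m" "j < m"
  shows "lin_ext \<phi> (free_gen i \<otimes>\<^bsub>free_algebra m\<^esub> free_gen j) = \<phi> [i, j]"
proof -
  have "{w. free_gen i w \<noteq> 0} = {[i]}" for i by (auto simp: free_gen_def)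
  then show ?thesis
    using assms by (simp add: lin_ext_mult free_gen_closed) (simp add: free_gen_def)
qed

lemma lin_ext_scalar: "lin_ext \<phi> (free_scalar r) = r * \<phi> []"
  by (subst lin_ext_superset[of "{[]}"]) (auto simp: free_scalar_def)

lemma pq_inner_unit:
  assumes "i < p + q"
  shows "pq_inner p q (unit_vec (p + q) i) (unit_vec (p + q) i) = (if i < p then 1 else - 1)"
proof -
  have "(\<Sum>k\<in>A. unit_vec (p + q) i $ k * unit_vec (p + q) i $ k) = (if i \<in> A then 1 else 0 :: real)"
    if "A \<subseteq> {..<p + q}" for A
  proof -
    have "(\<Sum>k\<in>A. unit_vec (p + q) i $ k * unit_vec (p + q) i $ k) =
        (\<Sum>k\<in>A. if k = i then 1 else 0 :: real)"
      using that by (intro sum.cong) (auto simp: subset_iff unit_vec_def)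
    then show ?thesis using finite_subset[OF that] by simp
  qed
  from this[of "{0..<p}"] this[of "{p..<p + q}"] show ?thesis
    using assms by (simp add: pq_inner_def subset_iff del: index_unit_vec)
qed

text \<open>The swap law kills the mixed relators in every context, and the sign in the square law
  cancels the metric term of the square relators. This is the tool for showing that an element of
  the Clifford algebra is nonzero.\<close>

lemma basis_coeff_clifford_ideal:
  assumes "a \<in> clifford_ideal p q"
  shows "lin_ext (basis_coeff p K) a = 0"
proof (rule lin_ext_genideal[OF clifford_relators_closed _ assms[unfolded clifford_ideal_def]])
  fix a u v assume "a \<in> clifford_relators p q"
  then show "lin_ext (\<lambda>w. basis_coeff p K (u @ w @ v)) a = 0"
  proof (cases rule: clifford_relators_cases)
    case (1 i j)
    then show ?thesis
      using basis_coeff_swap[of i j p K u v]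
      by (simp add: lin_ext_add free_mult_closed free_gen_closed lin_ext_gen_mult)
  next
    case (2 i)
    then show ?thesis
      using basis_coeff_square[of p K u i v]
      by (simp add: lin_ext_add free_mult_closed free_gen_closed free_scalar_closed
          lin_ext_gen_mult lin_ext_scalar pq_inner_unit)
  qed
qed

section \<open>Products of vectors and the polarised Clifford relation\<close>

lemma free_vector_apply:
  "free_vector m x w = (case w of [i] \<Rightarrow> if i < m then x $ i else 0 | _ \<Rightarrow> 0)"
  by (auto simp: free_vector_def free_gen_def if_distrib cong: if_cong split: list.split)

lemma free_vector_mult_apply:
  "(free_vector m x \<otimes>\<^bsub>free_algebra m\<^esub> free_vector m y) w =
    (case w of [i, j] \<Rightarrow> if i < m \<and> j < m then x $ i * y $ j else 0 | _ \<Rightarrow> 0)"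
proof -
  let ?g = "\<lambda>(u, v). free_vector m x u * free_vector m y v"
  have "?g z = 0" if "z \<in> {(u, v). u @ v = w}" "length w \<noteq> 2" for z
    using that by (auto simp: free_vector_apply split: list.splits)
  then have *: "sum ?g {(u, v). u @ v = w} = 0" if "length w \<noteq> 2"
    using that by (intro sum.neutral) blast
  have **: "sum ?g {(u, v). u @ v = w} = ?g ([i], [j])" if "w = [i, j]" for i j
  proof -
    have "sum ?g {(u, v). u @ v = w} = sum ?g {([i], [j])}"
      using that finite_splits[of w]
      by (intro sum.mono_neutral_right) (auto simp: free_vector_apply Cons_eq_append_conv append_eq_Cons_conv split: list.splits)
    then show ?thesis by simp
  qed
  show ?thesis
  proof (cases "length w = 2")
    case True
    then obtain i j where "w = [i, j]" by (auto simp: length_Suc_conv numeral_2_eq_2)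
    then show ?thesis using **[of i j] by (simp add: free_algebra_def free_vector_apply)
  next
    case False
    then show ?thesis using * by (auto simp: free_algebra_def split: list.split)
  qed
qed

lemma free_vector_add:
  assumes "x \<in> carrier_vec m" "y \<in> carrier_vec m"
  shows "free_vector m x \<oplus>\<^bsub>free_algebra m\<^esub> free_vector m y = free_vector m (x + y)"
  using assms by (auto simp: free_add_apply free_vector_apply fun_eq_iff split: list.split)

lemma clifford_ideal_scale: "a \<in> clifford_ideal p q \<Longrightarrow> (\<lambda>w. r * a w) \<in> clifford_ideal p q"
  using ideal.I_l_closed[OF ideal_clifford_ideal _ free_scalar_closed, of a p q r]
  by (simp add: free_scalar_mult)

lemma clifford_ideal_add:
  assumes "a \<in> clifford_ideal p q" "b \<in> clifford_ideal p q"
  shows "(\<lambda>w. a w + b w) \<in> clifford_ideal p q"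
  using additive_subgroup.a_closed[OF ideal.axioms(1)[OF ideal_clifford_ideal] assms]
  by (simp add: free_algebra_def)

lemma clifford_ideal_sum:
  assumes "\<And>k. k \<in> A \<Longrightarrow> g k \<in> clifford_ideal p q"
  shows "(\<lambda>w. \<Sum>k\<in>A. g k w) \<in> clifford_ideal p q"
proof -
  have 0: "(\<lambda>w. 0) \<in> clifford_ideal p q"
    using additive_subgroup.zero_closed[OF ideal.axioms(1)[OF ideal_clifford_ideal]]
    by (simp add: free_algebra_def)
  show ?thesis
    \<comment> \<open>Zero serves both the empty sum and the default value of a sum over an infinite
      set.\<close>
    using assms by (induction A rule: infinite_finite_induct) (auto simp: 0 intro: clifford_ideal_add)
qed

text \<open>The relation \<open>ab + ba = -2<a,b>\<close> with everything moved to one side, as a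
  function on words so that identities can be checked coefficientwise.\<close>

definition anticomm :: "nat \<Rightarrow> nat \<Rightarrow> real vec \<Rightarrow> real vec \<Rightarrow> nat list \<Rightarrow> real" where
  "anticomm p q x y = (\<lambda>w.
     (free_vector (p + q) x \<otimes>\<^bsub>free_algebra (p + q)\<^esub> free_vector (p + q) y) w +
     (free_vector (p + q) y \<otimes>\<^bsub>free_algebra (p + q)\<^esub> free_vector (p + q) x) w +
     free_scalar (2 * pq_inner p q x y) w)"

lemma anticomm_pair:
  "anticomm p q x y [k, l] =
    (if k < p + q \<and> l < p + q then x $ k * y $ l + y $ k * x $ l else 0)"
  by (simp add: anticomm_def free_vector_mult_apply free_scalar_def)

lemma free_vector_unit: "i < m \<Longrightarrow> free_vector m (unit_vec m i) = free_gen i"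
  by (auto simp: free_vector_apply free_gen_def fun_eq_iff split: list.split)

lemma pq_inner_unit_distinct:
  assumes "i \<noteq> j"
  shows "pq_inner p q (unit_vec (p + q) i) (unit_vec (p + q) j) = 0"
proof -
  have "(\<Sum>k\<in>A. unit_vec (p + q) i $ k * unit_vec (p + q) j $ k) = (0 :: real)"
    if "A \<subseteq> {..<p + q}" for A
    using that assms by (intro sum.neutral) (auto simp: subset_iff unit_vec_def)
  from this[of "{0..<p}"] this[of "{p..<p + q}"] show ?thesis
    by (simp add: pq_inner_def subset_iff)
qed

text \<open>For \<open>i = j\<close> this is twice the square relator; otherwise the metric term
  vanishes and it is the mixed relator itself.\<close>

lemma anticomm_unit_in_ideal:
  assumes "i < p + q" "j < p + q"
  shows "anticomm p q (unit_vec (p + q) i) (unit_vec (p + q) j) \<in> clifford_ideal p q"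
proof -
  interpret ring "free_algebra (p + q)" by (rule ring_free_algebra)
  have rel: "clifford_relators p q \<subseteq> clifford_ideal p q"
    unfolding clifford_ideal_def by (rule genideal_self[OF clifford_relators_closed])
  show ?thesis
  proof (cases "i = j")
    case True
    let ?r = "free_gen i \<otimes>\<^bsub>free_algebra (p + q)\<^esub> free_gen i \<oplus>\<^bsub>free_algebra (p + q)\<^esub>
        free_scalar (pq_inner p q (unit_vec (p + q) i) (unit_vec (p + q) i))"
    have "?r \<in> clifford_ideal p q"
      using rel assms by (auto simp: clifford_relators_def)
    from clifford_ideal_scale[OF this, of 2] show ?thesis
      using assms True
      by (simp add: anticomm_def free_vector_unit free_add_apply free_scalar_def distrib_left
          if_distrib[of "\<lambda>r. 2 * r"] cong: if_cong)
  next
    case False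
    have "free_gen i \<otimes>\<^bsub>free_algebra (p + q)\<^esub> free_gen j \<oplus>\<^bsub>free_algebra (p + q)\<^esub>
        free_gen j \<otimes>\<^bsub>free_algebra (p + q)\<^esub> free_gen i \<in> clifford_ideal p q"
      using rel assms False by (auto simp: clifford_relators_def)
    moreover have "free_gen i \<otimes>\<^bsub>free_algebra (p + q)\<^esub> free_gen j \<oplus>\<^bsub>free_algebra (p + q)\<^esub>
        free_gen j \<otimes>\<^bsub>free_algebra (p + q)\<^esub> free_gen i =
        anticomm p q (unit_vec (p + q) i) (unit_vec (p + q) j)"
      using assms False
      by (simp add: anticomm_def free_vector_unit free_add_apply free_scalar_def
          pq_inner_unit_distinct fun_eq_iff)
    ultimately show ?thesis by simp
  qed
qed

lemma pq_inner_eq_sum: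
  "pq_inner p q x y = (\<Sum>i<p + q. (if i < p then 1 else - 1) * (x $ i * y $ i))"
proof -
  have "{..<p + q} = {0..<p} \<union> {p..<p + q}" by auto
  then have "(\<Sum>i<p + q. (if i < p then 1 else - 1) * (x $ i * y $ i)) =
     (\<Sum>i = 0..<p. (if i < p then 1 else - 1) * (x $ i * y $ i)) +
     (\<Sum>i = p..<p + q. (if i < p then 1 else - 1) * (x $ i * y $ i))"
    by (simp only:) (rule sum.union_disjoint, auto)
  also have "\<dots> = (\<Sum>i = 0..<p. x $ i * y $ i) + (\<Sum>i = p..<p + q. - (x $ i * y $ i))"
    by (intro arg_cong2[where f = "(+)"] sum.cong) auto
  finally show ?thesis by (simp add: pq_inner_def sum_negf)
qed

text \<open>Bilinearity reduces the claim to unit vectors. The expansion is compared word by word;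
  only words of length 0 and 2 can have nonzero coefficients.\<close>

lemma anticomm_in_ideal: "anticomm p q x y \<in> clifford_ideal p q"
proof -
  let ?m = "p + q"
  let ?a = "\<lambda>i j. anticomm p q (unit_vec ?m i) (unit_vec ?m j)"
  let ?\<eta> = "\<lambda>i j. pq_inner p q (unit_vec ?m i) (unit_vec ?m j)"
  have \<eta>: "?\<eta> i j = (if j = i then if i < p then 1 else - 1 else 0)" if "i < ?m" "j < ?m" for i j
    using that by (auto simp: pq_inner_unit pq_inner_unit_distinct)
  have a0: "?a i j [] = (if j = i then if i < p then 2 else - 2 else 0)"
    if "i < ?m" "j < ?m" for i j
    using that by (simp add: anticomm_def free_vector_mult_apply free_scalar_def \<eta>)
  have a2: "?a i j [k, l] =
      (if k = i \<and> l = j then 1 else 0) + (if k = j \<and> l = i then 1 else 0)"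
    if "i < ?m" "j < ?m" for i j k l
  proof (cases "k < ?m \<and> l < ?m")
    case True
    then have "?a i j [k, l] = (if k = i then 1 else 0) * (if l = j then 1 else 0) +
        (if k = j then 1 else 0) * (if l = i then 1 else 0)"
      using that by (simp only: anticomm_pair index_unit_vec if_True simp_thms)
    then show ?thesis
      by (cases "k = i"; cases "l = j"; cases "k = j"; cases "l = i"; simp only: if_True if_False simp_thms)
  next
    case False
    then have "\<not> (k = i \<and> l = j)" "\<not> (k = j \<and> l = i)"
      using that by blast+
    then show ?thesis
      using False by (simp only: anticomm_pair if_False)
  qed
  have a1: "?a i j [k] = 0" and a3: "?a i j (k # l # h # t) = 0" for i j k l h t
    by (simp_all add: anticomm_def free_vector_mult_apply free_scalar_def)
  have "anticomm p q x y = (\<lambda>w. \<Sum>i<?m. \<Sum>j<?m. x $ i * y $ j * ?a i j w)"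
  proof
    fix w :: "nat list"
    consider "w = []" | k l where "w = [k, l]" | k where "w = [k]" | k l h t where "w = k # l # h # t"
      by (metis neq_Nil_conv)
    then show "anticomm p q x y w = (\<Sum>i<?m. \<Sum>j<?m. x $ i * y $ j * ?a i j w)"
    proof cases
      case 1
      \<comment> \<open>The metric is diagonal, so the double sum collapses to its diagonal.\<close>
      have "(\<Sum>i<?m. \<Sum>j<?m. x $ i * y $ j * ?a i j w) =
          (\<Sum>i<?m. \<Sum>j<?m. if j = i then 2 * ((if i < p then 1 else - 1) * (x $ i * y $ i)) else 0)"
        using 1 by (intro sum.cong) (auto simp: a0)
      also have "\<dots> = 2 * pq_inner p q x y"
        by (simp add: pq_inner_eq_sum sum_distrib_left)
      finally show ?thesis
        using 1 by (simp add: anticomm_def free_vector_mult_apply free_scalar_def)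
    next
      case (2 k l)
      \<comment> \<open>The two sums come from the two orders of multiplication; for
        \<open>k = l\<close> both contribute, which produces the factor 2.\<close>
      have "(\<Sum>i<?m. \<Sum>j<?m. x $ i * y $ j * ?a i j w) =
          (\<Sum>i<?m. \<Sum>j<?m. if j = l then if i = k then x $ k * y $ l else 0 else 0) +
          (\<Sum>i<?m. \<Sum>j<?m. if j = k then if i = l then x $ l * y $ k else 0 else 0)"
        using 2 unfolding sum.distrib[symmetric] by (intro sum.cong) (auto simp: a2)
      also have "\<dots> = (if k < ?m \<and> l < ?m then x $ k * y $ l + y $ k * x $ l else 0)"
        by (cases "k < ?m"; cases "l < ?m"; simp)
      finally show ?thesis
        using 2 by (simp add: anticomm_pair)
    qed (simp_all add: anticomm_def free_vector_mult_apply free_scalar_def a1 a3)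
  qed
  also have "\<dots> \<in> clifford_ideal p q"
    by (intro clifford_ideal_sum clifford_ideal_scale anticomm_unit_in_ideal) auto
  finally show ?thesis .
qed

section \<open>Sums and equality of products in the quotient\<close>

lemma clifford_vec_add:
  assumes "x \<in> carrier_vec (p + q)" "y \<in> carrier_vec (p + q)"
  shows "clifford_vec p q x \<oplus>\<^bsub>clifford p q\<^esub> clifford_vec p q y = clifford_vec p q (x + y)"
  using ring_hom_add[OF ideal.rcos_ring_hom[OF ideal_clifford_ideal] free_vector_closed free_vector_closed]
  by (simp add: clifford_vec_def clifford_def free_vector_add[OF assms, symmetric])

text \<open>Cosets agree when their representatives differ by an element of the ideal. One direction
  of the result exhibits this difference as a combination of anticommutators, the other applies
  functionals to it.\<close>

lemma clifford_vec_mult_eq_iff: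
  "clifford_vec p q x \<otimes>\<^bsub>clifford p q\<^esub> clifford_vec p q y =
   clifford_vec p q x' \<otimes>\<^bsub>clifford p q\<^esub> clifford_vec p q y' \<longleftrightarrow>
   (\<lambda>w. (free_vector (p + q) x \<otimes>\<^bsub>free_algebra (p + q)\<^esub> free_vector (p + q) y) w -
     (free_vector (p + q) x' \<otimes>\<^bsub>free_algebra (p + q)\<^esub> free_vector (p + q) y') w) \<in> clifford_ideal p q"
proof -
  let ?F = "free_algebra (p + q)"
  interpret F: ring ?F by (rule ring_free_algebra)
  have mult: "clifford_vec p q x \<otimes>\<^bsub>clifford p q\<^esub> clifford_vec p q y =
      clifford_ideal p q +>\<^bsub>?F\<^esub> (free_vector (p + q) x \<otimes>\<^bsub>?F\<^esub> free_vector (p + q) y)" for x y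
    using ring_hom_mult[OF ideal.rcos_ring_hom[OF ideal_clifford_ideal] free_vector_closed free_vector_closed]
    by (simp add: clifford_vec_def clifford_def)
  have minus: "a \<ominus>\<^bsub>?F\<^esub> b = (\<lambda>w. a w - b w)" if "b \<in> carrier ?F" for a b
    using that by (simp add: a_minus_def free_a_inv) (simp add: free_algebra_def)
  show ?thesis
    unfolding mult
    by (subst F.quotient_eq_iff_same_a_r_cos[OF ideal_clifford_ideal, symmetric])
      (simp_all add: free_mult_closed free_vector_closed minus)
qed

section \<open>The two implications on a single quad\<close>

lemma pq_inner_minus_left:
  assumes "x \<in> carrier_vec (p + q)" "y \<in> carrier_vec (p + q)"
  shows "pq_inner p q (x - y) z = pq_inner p q x z - pq_inner p q y z"
  using assms by (simp add: pq_inner_def left_diff_distrib sum_subtractf)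

lemma pq_inner_smult_left:
  assumes "x \<in> carrier_vec (p + q)"
  shows "pq_inner p q (c \<cdot>\<^sub>v x) z = c * pq_inner p q x z"
  using assms by (simp add: pq_inner_def sum_distrib_left mult.assoc right_diff_distrib)

lemma pq_inner_commute: "pq_inner p q x y = pq_inner p q y x"
  by (simp add: pq_inner_def mult.commute)

lemma pq_inner_add_right:
  assumes "x \<in> carrier_vec (p + q)" "y \<in> carrier_vec (p + q)"
  shows "pq_inner p q z (x + y) = pq_inner p q z x + pq_inner p q z y"
  using assms by (simp add: pq_inner_def distrib_left sum.distrib)

lemma pq_inner_minus_right:
  assumes "x \<in> carrier_vec (p + q)" "y \<in> carrier_vec (p + q)"
  shows "pq_inner p q z (x - y) = pq_inner p q z x - pq_inner p q z y"
  using pq_inner_minus_left[OF assms] by (simp only: pq_inner_commute[of p q z])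

text \<open>
  With \<open>D = C - B\<close> and \<open>E - A = c D\<close> the difference of the two products is
  \<open>P D + D P + (1 - c) D\<^sup>2\<close> for \<open>P = B - A\<close>, a scalar in the Clifford algebra. That scalar is
  proportional to \<open>\<langle>D, E + A\<rangle>\<close>, and \<open>c \<langle>D, E + A\<rangle> = \<langle>E, E\<rangle> - \<langle>A, A\<rangle> = 0\<close>.
\<close>

lemma moutard_quad_imp_parallelogram:
  assumes V: "A \<in> carrier_vec (p + q)" "B \<in> carrier_vec (p + q)" "C \<in> carrier_vec (p + q)"
      "E \<in> carrier_vec (p + q)"
    and n: "pq_inner p q A A = \<kappa>" "pq_inner p q B B = \<kappa>" "pq_inner p q C C = \<kappa>" "pq_inner p q E E = \<kappa>"
    and "E \<noteq> A" and c: "E - A = c \<cdot>\<^sub>v (C - B)"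
  shows "clifford_vec p q (E - B) \<otimes>\<^bsub>clifford p q\<^esub> clifford_vec p q (B - A) =
    clifford_vec p q (E - C) \<otimes>\<^bsub>clifford p q\<^esub> clifford_vec p q (C - A)"
proof -
  let ?D = "C - B" and ?P = "B - A"
  have "c \<noteq> 0"
  proof
    assume "c = 0"
    then have "E $ i = A $ i" if "i < p + q" for i
      using arg_cong[OF c, of "\<lambda>v. v $ i"] that V by simp
    then show False using \<open>E \<noteq> A\<close> V by (metis carrier_vecD eq_vecI)
  qed
  note bilinear = pq_inner_minus_left pq_inner_add_right pq_inner_minus_right
  have "c * pq_inner p q ?D (E + A) = pq_inner p q (E - A) (E + A)"
    using V c by (simp add: pq_inner_smult_left)
  also have "\<dots> = 0"
    using V n pq_inner_commute[of p q A E] by (simp add: bilinear)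
  finally have DEA: "pq_inner p q ?D (E + A) = 0" using \<open>c \<noteq> 0\<close> by simp
  have ED: "pq_inner p q (E - A) ?D = c * pq_inner p q ?D ?D"
    using V c by (simp add: pq_inner_smult_left)
  \<comment> \<open>As \<open><B,B> = <C,C>\<close>, one has
    \<open>2<P,D> + <D,D> = -2<A,D>\<close>; subtracting \<open>c<D,D> = <E - A,D>\<close> leaves
    \<open>-<D,E + A>\<close>.\<close>
  have scalar: "2 * pq_inner p q ?P ?D + (1 - c) * pq_inner p q ?D ?D = 0"
    using DEA ED V n pq_inner_commute[of p q A E] pq_inner_commute[of p q B C]
      pq_inner_commute[of p q A B] pq_inner_commute[of p q A C]
      pq_inner_commute[of p q E B] pq_inner_commute[of p q E C]
    by (simp add: bilinear algebra_simps)
  have Ei: "E $ i = A $ i + c * (C $ i - B $ i)" if "i < p + q" for i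
    using arg_cong[OF c, of "\<lambda>v. v $ i"] that V by simp
  let ?m = "\<lambda>x y. free_vector (p + q) x \<otimes>\<^bsub>free_algebra (p + q)\<^esub> free_vector (p + q) y"
  \<comment> \<open>The factor is halved because \<open>anticomm p q ?D ?D\<close> contains the
    square of \<open>D\<close> twice. The constant terms agree by \<open>scalar\<close>, the
    quadratic ones by \<open>E = A + c D\<close>.\<close>
  have "(\<lambda>w. ?m (E - B) ?P w - ?m (E - C) (C - A) w) =
      (\<lambda>w. anticomm p q ?P ?D w + (1 - c) / 2 * anticomm p q ?D ?D w)"
  proof
    fix w
    show "?m (E - B) ?P w - ?m (E - C) (C - A) w =
        anticomm p q ?P ?D w + (1 - c) / 2 * anticomm p q ?D ?D w"
    proof (cases "w = []")
      case True
      then show ?thesis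
        using scalar by (simp add: anticomm_def free_vector_mult_apply free_scalar_def field_simps)
    next
      case False
      then show ?thesis
        using V by (auto simp: anticomm_def free_vector_mult_apply free_scalar_def Ei field_simps split: list.split)
    qed
  qed
  moreover have "\<dots> \<in> clifford_ideal p q"
    by (intro clifford_ideal_add clifford_ideal_scale anticomm_in_ideal)
  ultimately show ?thesis
    unfolding clifford_vec_mult_eq_iff by simp
qed

text \<open>On a product of two vectors the functional reads off the coefficient of
  \<open>e\<^sub>k e\<^sub>l\<close>, a 2 by 2 minor, that is, a coordinate of the wedge
  product.\<close>

lemma lin_ext_vector_mult_diff:
  assumes "k < l" "l < p + q"
  shows "lin_ext (basis_coeff p {k, l})
      (\<lambda>w. (free_vector (p + q) x \<otimes>\<^bsub>free_algebra (p + q)\<^esub> free_vector (p + q) y) w -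
        (free_vector (p + q) x' \<otimes>\<^bsub>free_algebra (p + q)\<^esub> free_vector (p + q) y') w)
    = (x $ k * y $ l - x $ l * y $ k) - (x' $ k * y' $ l - x' $ l * y' $ k)"
proof -
  let ?d = "\<lambda>w. (free_vector (p + q) x \<otimes>\<^bsub>free_algebra (p + q)\<^esub> free_vector (p + q) y) w -
        (free_vector (p + q) x' \<otimes>\<^bsub>free_algebra (p + q)\<^esub> free_vector (p + q) y') w"
  let ?W = "(\<lambda>(i, j). [i, j]) ` ({..<p + q} \<times> {..<p + q})"
  have "?d w = 0" if "w \<notin> ?W" for w
    using that by (auto simp: free_vector_mult_apply split: list.split)
  then have "{w. ?d w \<noteq> 0} \<subseteq> ?W"
    by blast
  then have "lin_ext (basis_coeff p {k, l}) ?d = (\<Sum>w\<in>?W. ?d w * basis_coeff p {k, l} w)"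
    by (intro lin_ext_superset) auto
  also have "\<dots> = (\<Sum>w\<in>{[k, l], [l, k]}. ?d w * basis_coeff p {k, l} w)"
    using assms by (intro sum.mono_neutral_right) (auto simp: basis_coeff_pair split: if_splits)
  finally show ?thesis
    using assms by (simp add: basis_coeff_pair free_vector_mult_apply)
qed

text \<open>Equal products have equal bivector parts, which forces all 2 by 2 minors of
  \<open>E - A\<close> and \<open>C - B\<close> to vanish; as \<open>C - B\<close> is nonzero,
  \<open>E - A\<close> is a multiple of it.\<close>

lemma parallelogram_quad_imp_moutard:
  assumes V: "A \<in> carrier_vec (p + q)" "B \<in> carrier_vec (p + q)" "C \<in> carrier_vec (p + q)"
      "E \<in> carrier_vec (p + q)"
    and "C \<noteq> B"
    and eq: "clifford_vec p q (E - B) \<otimes>\<^bsub>clifford p q\<^esub> clifford_vec p q (B - A) =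
      clifford_vec p q (E - C) \<otimes>\<^bsub>clifford p q\<^esub> clifford_vec p q (C - A)"
  obtains c where "E - A = c \<cdot>\<^sub>v (C - B)"
proof -
  \<comment> \<open>The wedge of \<open>E - B\<close> and \<open>B - A\<close> equals that of
    \<open>E - A\<close> and \<open>B - A\<close>, and similarly with \<open>C\<close> for
    \<open>B\<close>; their difference is the wedge of \<open>E - A\<close> and
    \<open>B - C\<close>.\<close>
  have minor: "(E $ k - A $ k) * (C $ l - B $ l) = (E $ l - A $ l) * (C $ k - B $ k)"
    if "k < l" "l < p + q" for k l
    using basis_coeff_clifford_ideal[OF eq[unfolded clifford_vec_mult_eq_iff], of "{k, l}"] that V
    by (simp add: lin_ext_vector_mult_diff algebra_simps)
  obtain h where h: "h < p + q" "C $ h \<noteq> B $ h"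
    using \<open>C \<noteq> B\<close> V by (metis carrier_vecD eq_vecI)
  \<comment> \<open>The factor is read off at a coordinate \<open>h\<close> where
    \<open>C - B\<close> does not vanish; the minors with \<open>h\<close> carry it to all
    others.\<close>
  have "E - A = ((E $ h - A $ h) / (C $ h - B $ h)) \<cdot>\<^sub>v (C - B)"
  proof (rule eq_vecI)
    fix i assume "i < dim_vec (((E $ h - A $ h) / (C $ h - B $ h)) \<cdot>\<^sub>v (C - B))"
    then have i: "i < p + q" using V by simp
    have "(E $ i - A $ i) * (C $ h - B $ h) = (E $ h - A $ h) * (C $ i - B $ i)"
      using minor[of i h] minor[of h i] h i by (cases i h rule: linorder_cases) auto
    then show "(E - A) $ i = (((E $ h - A $ h) / (C $ h - B $ h)) \<cdot>\<^sub>v (C - B)) $ i"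
      using h i V by (simp add: field_simps)
  qed (use V in simp)
  then show ?thesis by (rule that)
qed

section \<open>From single quads to nets\<close>

lemma shift_closed: "x \<in> carrier_vec n \<Longrightarrow> shift n i x \<in> carrier_vec n"
  by (simp add: shift_def)

lemma shift_commute:
  "x \<in> carrier_vec n \<Longrightarrow> shift n i (shift n j x) = shift n j (shift n i x)"
  by (auto simp: shift_def)

theorem proposition5p3:
  fixes n p q :: nat and f :: "int vec \<Rightarrow> real vec"
  assumes "f \<in> carrier_vec n \<rightarrow> carrier_vec (p + q)"
    and "in_quadric n p q f"
    and "nonvanishing_diagonals n f"
  shows "moutard_net n f \<longleftrightarrow>
    parallelogram_net (clifford p q) n (\<lambda>i x. clifford_vec p q (f (shift n i x) - f x))"
proof -
  have V: "f x \<in> carrier_vec (p + q)" if "x \<in> carrier_vec n" for x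
    using assms(1) that by blast
  obtain \<kappa> where \<kappa>: "\<And>x. x \<in> carrier_vec n \<Longrightarrow> pq_inner p q (f x) (f x) = \<kappa>"
    using assms(2) by (auto simp: in_quadric_def)
  let ?M = "\<lambda>x i j a. f (shift n j (shift n i x)) - f x = a \<cdot>\<^sub>v (f (shift n j x) - f (shift n i x))"
  let ?p = "\<lambda>i x. clifford_vec p q (f (shift n i x) - f x)"
  have quad: "(\<exists>a. ?M x i j a) \<longleftrightarrow>
      ?p i x \<oplus>\<^bsub>clifford p q\<^esub> ?p j (shift n i x) = ?p j x \<oplus>\<^bsub>clifford p q\<^esub> ?p i (shift n j x) \<and>
      ?p j (shift n i x) \<otimes>\<^bsub>clifford p q\<^esub> ?p i x = ?p i (shift n j x) \<otimes>\<^bsub>clifford p q\<^esub> ?p j x"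
    if x: "x \<in> carrier_vec n" and ij: "i < j" "j < n" for x i j
  proof -
    let ?A = "f x" and ?B = "f (shift n i x)" and ?C = "f (shift n j x)"
      and ?E = "f (shift n j (shift n i x))"
    have vs: "?A \<in> carrier_vec (p + q)" "?B \<in> carrier_vec (p + q)" "?C \<in> carrier_vec (p + q)"
        "?E \<in> carrier_vec (p + q)"
      using x V by (simp_all add: shift_closed)
    have ns: "pq_inner p q ?A ?A = \<kappa>" "pq_inner p q ?B ?B = \<kappa>" "pq_inner p q ?C ?C = \<kappa>"
        "pq_inner p q ?E ?E = \<kappa>"
      using x \<kappa> by (simp_all add: shift_closed)
    have d: "?E \<noteq> ?A" "?C \<noteq> ?B"
      using assms(3) x ij by (auto simp: nonvanishing_diagonals_def)
    have sc: "shift n i (shift n j x) = shift n j (shift n i x)"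
      using x by (rule shift_commute)
    \<comment> \<open>Both paths around the quad telescope to \<open>?E - ?A\<close>.\<close>
    have "(?B - ?A) + (?E - ?B) = (?C - ?A) + (?E - ?C)"
      using vs by auto
    then have "?p i x \<oplus>\<^bsub>clifford p q\<^esub> ?p j (shift n i x) = ?p j x \<oplus>\<^bsub>clifford p q\<^esub> ?p i (shift n j x)"
      using vs by (simp add: clifford_vec_add sc)
    moreover have "(\<exists>a. ?M x i j a) \<longleftrightarrow>
        ?p j (shift n i x) \<otimes>\<^bsub>clifford p q\<^esub> ?p i x = ?p i (shift n j x) \<otimes>\<^bsub>clifford p q\<^esub> ?p j x"
      unfolding sc
    proof
      assume "\<exists>a. ?M x i j a"
      then obtain a where "?M x i j a" ..
      from moutard_quad_imp_parallelogram[OF vs ns d(1) this]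
      show "?p j (shift n i x) \<otimes>\<^bsub>clifford p q\<^esub> ?p i x =
        clifford_vec p q (?E - ?C) \<otimes>\<^bsub>clifford p q\<^esub> ?p j x" .
    next
      assume "?p j (shift n i x) \<otimes>\<^bsub>clifford p q\<^esub> ?p i x =
        clifford_vec p q (?E - ?C) \<otimes>\<^bsub>clifford p q\<^esub> ?p j x"
      from parallelogram_quad_imp_moutard[OF vs d(2) this]
      show "\<exists>a. ?M x i j a" by metis
    qed
    ultimately show ?thesis by simp
  qed
  have "moutard_net n f \<longleftrightarrow> (\<forall>x \<in> carrier_vec n. \<forall>i j. i < j \<and> j < n \<longrightarrow> (\<exists>a. ?M x i j a))"
  proof
    assume *: "\<forall>x \<in> carrier_vec n. \<forall>i j. i < j \<and> j < n \<longrightarrow> (\<exists>a. ?M x i j a)"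
    show "moutard_net n f"
      unfolding moutard_net_def
    \<comment> \<open>Choice assembles the factors of the individual quads into one
      function.\<close>
    proof (rule exI[of _ "\<lambda>i j x. SOME a. ?M x i j a"], intro ballI allI impI)
      fix x :: "int vec" and i j assume "x \<in> carrier_vec n" "i < j \<and> j < n"
      then have "\<exists>a. ?M x i j a" using * by blast
      then show "?M x i j (SOME a. ?M x i j a)" by (rule someI_ex)
    qed
  qed (unfold moutard_net_def, blast)
  then show ?thesis
    using quad by (simp add: parallelogram_net_def clifford_vec_closed)
qed

end
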